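(* Let $\phi$ be a closed trace formula of the restricted grammar and $\mathsf{can}(\phi)=\langle S_\phi,T_\phi\rangle$. Then $\mathcal{S}_{tr}[\![S_\phi]\!]$ (computed relative to the procedure table $T_\phi$) is stutter-equivalent to $[\![\phi]\!]$, i.e. $\widetilde{\mathcal{S}_{tr}[\![S_\phi]\!]}=\widetilde{[\![\phi]\!]}$.
   Context: $\mathbf{State}$ = maps from program variables to $\mathbb{Z}$; $\mathbf{State}^+$ = nonempty finite state sequences. $\mathrm{Rec}^\ast$ statements: $S ::= \mathbf{skip} \mid x := a \mid S_1;S_2 \mid \mathbf{if}\ b\ \mathbf{then}\ S_1\ \mathbf{else}\ S_2 \mid \mathbf{if}\ \ast\ \mathbf{then}\ S_1\ \mathbf{else}\ S_2 \mid m()$, relative to a table of declarations $m\,\{S_m\}$. Trace semantics: with $A|_b=\{s\cdot\sigma\in A:\mathcal{B}[\![b]\!](s)=\mathbf{tt}\}$, $\sharp A=\{s\cdot s\cdot\sigma:s\cdot\sigma\in A\}$, $A\frown B=\{\sigma_A\cdot s\cdot\sigma_B:\sigma_A\cdot s\in A,s\cdot\sigma_B\in B\}$: $\mathcal{S}_{tr}[\![\mathbf{skip}]\!]_\rho=\{s\cdot s\}$, $\mathcal{S}_{tr}[\![x:=a]\!]_\rho=\{s\cdot s[x\mapsto\mathcal{A}[\![a]\!](s)]\}$, sequencing is $\frown$, $\mathcal{S}_{tr}[\![\mathbf{if}\ b\ \mathbf{then}\ S_1\ \mathbf{else}\ S_2]\!]_\rho=(\sharp\mathcal{S}_{tr}[\![S_1]\!]_\rho)|_b\cup(\sharp\mathcal{S}_{tr}[\![S_2]\!]_\rho)|_{\neg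 b}$, $\mathcal{S}_{tr}[\![\mathbf{if}\ \ast\ \mathbf{then}\ S_1\ \mathbf{else}\ S_2]\!]_\rho=\sharp\mathcal{S}_{tr}[\![S_1]\!]_\rho\cup\sharp\mathcal{S}_{tr}[\![S_2]\!]_\rho$, $\mathcal{S}_{tr}[\![m()]\!]_\rho=\rho(m)$; $\rho_0$ is the least fixed point of $\rho\mapsto(\sharp\mathcal{S}_{tr}[\![S_m]\!]_\rho)_m$ and $\mathcal{S}_{tr}[\![S]\!]=\mathcal{S}_{tr}[\![S]\!]_{\rho_0}$. Restricted trace formulas: $\phi ::= \mathit{Id} \mid \mathit{Sb}^a_x \mid X \mid p\wedge\phi \mid \phi\vee\psi \mid \phi\frown\psi \mid \mu X.\phi$ ($p$ a Boolean expression/state formula, all recursion variables uniquely named), with $[\![\mathit{Id}]\!]=\{s\cdot s\}$, $[\![\mathit{Sb}^a_x]\!]=\{s\cdot s[x\mapsto\mathcal{A}[\![a]\!](s)]\}$, $[\![X]\!]_{\mathcal{V}}=\mathcal{V}(X)$, $[\![p\wedge\phi]\!]=\{s\cdot\sigma:s\models p\}\cap[\![\phi]\!]$, $\vee$ as union, $\frown$ as chop, $[\![\mu X.\phi]\!]_{\mathcal{V}}=\bigcap\{\gamma:[\![\phi]\!]_{\mathcal{V}[X\mapsto\gamma]}\subseteq\gamma\}$. Canonical program $\mathsf{can}(\phi)=\langle S_\phi,T_\phi\rangle$: $\mathsf{can}(\mathit{Id})=\langle\mathbf{skip},\epsilon\rangle$; $\mathsf{can}(\mathit{Sb}^a_x)=\langle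 x:=a,\epsilon\rangle$; $\mathsf{can}(p\wedge\phi)=\langle\mathbf{if}\ p\ \mathbf{then}\ S_\phi\ \mathbf{else}\ \mathbf{diverge},T_\phi\rangle$; $\mathsf{can}(\phi\vee\psi)=\langle\mathbf{if}\ \ast\ \mathbf{then}\ S_\phi\ \mathbf{else}\ S_\psi,T_\phi\,T_\psi\rangle$; $\mathsf{can}(\phi\frown\psi)=\langle S_\phi;S_\psi,T_\phi\,T_\psi\rangle$; $\mathsf{can}(\mu X.\phi)=\langle m_X(),T_\phi\,\{m_X\,\{S_\phi\}\}\rangle$; $\mathsf{can}(X)=\langle m_X(),\epsilon\rangle$; $\epsilon$ empty table, juxtaposition concatenation, $\mathbf{diverge}=\mathit{abort}()$ with $\mathit{abort}\,\{\mathit{abort}()\}$ included in the table when needed. Stuttering: $\tilde\sigma$ is obtained from a trace $\sigma$ by replacing every maximal block $s\cdot s\cdots s$ of repeated consecutive equal states by a single $s$; $\widetilde{A}=\{\tilde\sigma:\sigma\in A\}$. *)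

theory Defs
  imports Main
begin

section \<open>States, traces and operations on sets of traces\<close>

type_synonym 'v state = "'v \<Rightarrow> int"
type_synonym 'v trace = "'v state list"

definition traces :: "'v trace set" where
  "traces = {\<sigma>. \<sigma> \<noteq> []}"

definition restrict :: "'v trace set \<Rightarrow> ('v state \<Rightarrow> bool) \<Rightarrow> 'v trace set" where
  "restrict A P = {s # \<sigma> | s \<sigma>. s # \<sigma> \<in> A \<and> P s}"

definition sharp :: "'v trace set \<Rightarrow> 'v trace set" where
  "sharp A = {s # s # \<sigma> | s \<sigma>. s # \<sigma> \<in> A}"

definition chop :: "'v trace set \<Rightarrow> 'v trace set \<Rightarrow> 'v trace set" where
  "chop A B = {\<sigma>A @ [s] @ \<sigma>B | \<sigma>A s \<sigma>B. \<sigma>A @ [s] \<in> A \<and> s # \<sigma>B \<in> B}"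

definition destutter :: "'v trace set \<Rightarrow> 'v trace set" where
  "destutter A = remdups_adj ` A"

definition stutter_equiv :: "'v trace set \<Rightarrow> 'v trace set \<Rightarrow> bool" where
  "stutter_equiv A B \<longleftrightarrow> destutter A = destutter B"

section \<open>Programs\<close>

text \<open>
  The syntax of arithmetic and Boolean expressions is left abstract: the types \<open>'a\<close> and \<open>'b\<close> of
  expressions are arbitrary, and their evaluation functions
  \<open>\<A> :: 'a \<Rightarrow> 'v state \<Rightarrow> int\<close> and \<open>\<B> :: 'b \<Rightarrow> 'v state \<Rightarrow> bool\<close> are parameters of the semantics.
\<close>

datatype ('v, 'a, 'b, 'm) stmt =
    Skip
  | Assign 'v 'a
  | Seq "('v, 'a, 'b, 'm) stmt" "('v, 'a, 'b, 'm) stmt"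
  | If 'b "('v, 'a, 'b, 'm) stmt" "('v, 'a, 'b, 'm) stmt"
  | IfStar "('v, 'a, 'b, 'm) stmt" "('v, 'a, 'b, 'm) stmt"
  | Call 'm

type_synonym ('v, 'a, 'b, 'm) proc_table = "('m \<times> ('v, 'a, 'b, 'm) stmt) list"

primrec stmt_sem ::
  "('a \<Rightarrow> 'v state \<Rightarrow> int) \<Rightarrow> ('b \<Rightarrow> 'v state \<Rightarrow> bool) \<Rightarrow> ('m \<Rightarrow> 'v trace set)
    \<Rightarrow> ('v, 'a, 'b, 'm) stmt \<Rightarrow> 'v trace set" where
  "stmt_sem \<A> \<B> \<rho> Skip = {[s, s] | s. True}"
| "stmt_sem \<A> \<B> \<rho> (Assign x a) = {[s, s(x := \<A> a s)] | s. True}"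
| "stmt_sem \<A> \<B> \<rho> (Seq S1 S2) = chop (stmt_sem \<A> \<B> \<rho> S1) (stmt_sem \<A> \<B> \<rho> S2)"
| "stmt_sem \<A> \<B> \<rho> (If b S1 S2) =
     restrict (sharp (stmt_sem \<A> \<B> \<rho> S1)) (\<lambda>s. \<B> b s) \<union>
     restrict (sharp (stmt_sem \<A> \<B> \<rho> S2)) (\<lambda>s. \<not> \<B> b s)"
| "stmt_sem \<A> \<B> \<rho> (IfStar S1 S2) =
     sharp (stmt_sem \<A> \<B> \<rho> S1) \<union> sharp (stmt_sem \<A> \<B> \<rho> S2)"
| "stmt_sem \<A> \<B> \<rho> (Call m) = \<rho> m"

text \<open>Procedures that are not declared in the table have no traces.\<close>

definition table_step ::
  "('a \<Rightarrow> 'v state \<Rightarrow> int) \<Rightarrow> ('b \<Rightarrow> 'v state \<Rightarrow> bool) \<Rightarrow> ('v, 'a, 'b, 'm) proc_table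
    \<Rightarrow> ('m \<Rightarrow> 'v trace set) \<Rightarrow> ('m \<Rightarrow> 'v trace set)" where
  "table_step \<A> \<B> T \<rho> =
     (\<lambda>m. case map_of T m of None \<Rightarrow> {} | Some S \<Rightarrow> sharp (stmt_sem \<A> \<B> \<rho> S))"

definition rho0 ::
  "('a \<Rightarrow> 'v state \<Rightarrow> int) \<Rightarrow> ('b \<Rightarrow> 'v state \<Rightarrow> bool) \<Rightarrow> ('v, 'a, 'b, 'm) proc_table
    \<Rightarrow> 'm \<Rightarrow> 'v trace set" where
  "rho0 \<A> \<B> T = lfp (table_step \<A> \<B> T)"

definition S_tr ::
  "('a \<Rightarrow> 'v state \<Rightarrow> int) \<Rightarrow> ('b \<Rightarrow> 'v state \<Rightarrow> bool) \<Rightarrow> ('v, 'a, 'b, 'm) proc_table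
    \<Rightarrow> ('v, 'a, 'b, 'm) stmt \<Rightarrow> 'v trace set" where
  "S_tr \<A> \<B> T S = stmt_sem \<A> \<B> (rho0 \<A> \<B> T) S"

lemma stmt_sem_mono: "\<rho> \<le> \<rho>' \<Longrightarrow> stmt_sem \<A> \<B> \<rho> S \<subseteq> stmt_sem \<A> \<B> \<rho>' S"
proof (induction S)
  case (Seq S1 S2)
  then show ?case by (simp add: chop_def) blast
next
  case (If b S1 S2)
  then show ?case by (simp add: restrict_def sharp_def) blast
next
  case (IfStar S1 S2)
  then show ?case by (simp add: sharp_def) blast
qed (auto simp: le_fun_def)

lemma table_step_mono: "mono (table_step \<A> \<B> T)"
proof (intro monoI le_funI)
  show "table_step \<A> \<B> T \<rho> m \<le> table_step \<A> \<B> T \<rho>' m" if "\<rho> \<le> \<rho>'" for \<rho> \<rho>' m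
    using stmt_sem_mono[OF that, of \<A> \<B>]
    by (cases "map_of T m") (simp_all add: table_step_def sharp_def, blast)
qed

text \<open>
  The fixed point \<^const>\<open>rho0\<close> is taken among all families of sets of lists. By the lemmas before and after
  this text it is also the least fixed point among families of subsets of \<^const>\<open>traces\<close>.
\<close>

lemma rho0_traces: "rho0 \<A> \<B> T m \<subseteq> traces"
proof -
  have "rho0 \<A> \<B> T = table_step \<A> \<B> T (rho0 \<A> \<B> T)"
    unfolding rho0_def by (rule lfp_unfold[OF table_step_mono])
  then have "rho0 \<A> \<B> T m = table_step \<A> \<B> T (rho0 \<A> \<B> T) m"
    by (rule fun_cong)
  also have "\<dots> \<subseteq> traces"
    by (auto simp: table_step_def sharp_def traces_def split: option.splits)
  finally show ?thesis .
qed

section \<open>Restricted trace formulas\<close>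

datatype ('v, 'a, 'b, 'x) formula =
    Id
  | Sb 'v 'a
  | Var 'x
  | Conj 'b "('v, 'a, 'b, 'x) formula"
  | Disj "('v, 'a, 'b, 'x) formula" "('v, 'a, 'b, 'x) formula"
  | Chop "('v, 'a, 'b, 'x) formula" "('v, 'a, 'b, 'x) formula"
  | Mu 'x "('v, 'a, 'b, 'x) formula"

primrec formula_sem ::
  "('a \<Rightarrow> 'v state \<Rightarrow> int) \<Rightarrow> ('b \<Rightarrow> 'v state \<Rightarrow> bool) \<Rightarrow> ('v, 'a, 'b, 'x) formula
    \<Rightarrow> ('x \<Rightarrow> 'v trace set) \<Rightarrow> 'v trace set" where
  "formula_sem \<A> \<B> Id V = {[s, s] | s. True}"
| "formula_sem \<A> \<B> (Sb x a) V = {[s, s(x := \<A> a s)] | s. True}"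
| "formula_sem \<A> \<B> (Var X) V = V X"
| "formula_sem \<A> \<B> (Conj p \<phi>) V = {s # \<sigma> | s \<sigma>. \<B> p s} \<inter> formula_sem \<A> \<B> \<phi> V"
| "formula_sem \<A> \<B> (Disj \<phi> \<psi>) V = formula_sem \<A> \<B> \<phi> V \<union> formula_sem \<A> \<B> \<psi> V"
| "formula_sem \<A> \<B> (Chop \<phi> \<psi>) V = chop (formula_sem \<A> \<B> \<phi> V) (formula_sem \<A> \<B> \<psi> V)"
| "formula_sem \<A> \<B> (Mu X \<phi>) V =
     \<Inter> {\<gamma>. \<gamma> \<subseteq> traces \<and> formula_sem \<A> \<B> \<phi> (V(X := \<gamma>)) \<subseteq> \<gamma>}"

primrec free_vars :: "('v, 'a, 'b, 'x) formula \<Rightarrow> 'x set" where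
  "free_vars Id = {}"
| "free_vars (Sb x a) = {}"
| "free_vars (Var X) = {X}"
| "free_vars (Conj p \<phi>) = free_vars \<phi>"
| "free_vars (Disj \<phi> \<psi>) = free_vars \<phi> \<union> free_vars \<psi>"
| "free_vars (Chop \<phi> \<psi>) = free_vars \<phi> \<union> free_vars \<psi>"
| "free_vars (Mu X \<phi>) = free_vars \<phi> - {X}"

definition closed :: "('v, 'a, 'b, 'x) formula \<Rightarrow> bool" where
  "closed \<phi> \<longleftrightarrow> free_vars \<phi> = {}"

text \<open>Names of the binders, one entry per occurrence of a fixed-point operator.\<close>

primrec binders :: "('v, 'a, 'b, 'x) formula \<Rightarrow> 'x list" where
  "binders Id = []"
| "binders (Sb x a) = []"
| "binders (Var X) = []"
| "binders (Conj p \<phi>) = binders \<phi>"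
| "binders (Disj \<phi> \<psi>) = binders \<phi> @ binders \<psi>"
| "binders (Chop \<phi> \<psi>) = binders \<phi> @ binders \<psi>"
| "binders (Mu X \<phi>) = X # binders \<phi>"

definition uniquely_named :: "('v, 'a, 'b, 'x) formula \<Rightarrow> bool" where
  "uniquely_named \<phi> \<longleftrightarrow> distinct (binders \<phi>) \<and> free_vars \<phi> \<inter> set (binders \<phi>) = {}"

section \<open>Canonical programs\<close>

datatype 'x proc_name = Proc 'x | Abort

abbreviation diverge :: "('v, 'a, 'b, 'x proc_name) stmt" where
  "diverge \<equiv> Call Abort"

text \<open>
  Every occurrence of \<^const>\<open>Conj\<close> contributes a declaration of \<^const>\<open>Abort\<close>. These declarations
  are all identical, so it does not matter which of them \<^const>\<open>map_of\<close> selects.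
\<close>

primrec can ::
  "('v, 'a, 'b, 'x) formula
    \<Rightarrow> ('v, 'a, 'b, 'x proc_name) stmt \<times> ('v, 'a, 'b, 'x proc_name) proc_table" where
  "can Id = (Skip, [])"
| "can (Sb x a) = (Assign x a, [])"
| "can (Var X) = (Call (Proc X), [])"
| "can (Conj p \<phi>) =
     (let (S, T) = can \<phi> in (If p S diverge, T @ [(Abort, Call Abort)]))"
| "can (Disj \<phi> \<psi>) =
     (let (S1, T1) = can \<phi>; (S2, T2) = can \<psi> in (IfStar S1 S2, T1 @ T2))"
| "can (Chop \<phi> \<psi>) =
     (let (S1, T1) = can \<phi>; (S2, T2) = can \<psi> in (Seq S1 S2, T1 @ T2))"
| "can (Mu X \<phi>) =
     (let (S, T) = can \<phi> in (Call (Proc X), T @ [(Proc X, S)]))"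

end

(*
  Stuttering inclusion "destutter A \<subseteq> destutter B" is preserved by all trace operations, and sharp is
  invisible to it.  Each inclusion then follows from minimality of one of the fixed points.  Formula
  into program: the saturation of rho0 (Proc X) under stuttering is a prefixed point of the body of
  mu X.  Program into formula: unique naming lets one family rho assign to every Proc X the saturated
  meaning of the only mu binding X (evaluated in the environment of its occurrence); this family is
  a prefixed point of the step function of the procedure table.
*)
theory Submission
  imports Defs
begin

section \<open>Stuttering inclusion\<close>

lemma destutter_iff: "\<tau> \<in> destutter A \<longleftrightarrow> (\<exists>\<sigma>\<in>A. \<tau> = remdups_adj \<sigma>)"
  by (auto simp: destutter_def)

lemma destutter_mono: "A \<subseteq> B \<Longrightarrow> destutter A \<subseteq> destutter B"
  by (auto simp: destutter_def)

lemma destutter_Un: "destutter (A \<union> B) = destutter A \<union> destutter B"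
  by (auto simp: destutter_def)

text \<open>Only the empty list destutters to the empty list. This discharges the side condition
  \<open>\<gamma> \<subseteq> traces\<close> in the meaning of \<open>Mu\<close>.\<close>

lemma destutter_le_traces:
  assumes "destutter A \<subseteq> destutter B" "B \<subseteq> traces"
  shows "A \<subseteq> traces"
proof -
  have "[] \<notin> destutter B"
    using assms(2) by (auto simp: destutter_iff traces_def eq_commute[of "[]"])
  then have "[] \<notin> A"
    using assms(1) by (force simp: destutter_def)
  then show ?thesis
    by (auto simp: traces_def)
qed

lemma destutter_sharp_le: "destutter (sharp A) \<subseteq> destutter A"
  by (auto simp: destutter_def sharp_def)

text \<open>\<open>sharp\<close> repeats a first state and drops the empty list, hence the
  restriction to \<open>traces\<close>.\<close>

lemma destutter_sharp: "A \<subseteq> traces \<Longrightarrow> destutter (sharp A) = destutter A"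
proof (rule antisym[OF destutter_sharp_le], rule subsetI)
  fix \<tau> assume "A \<subseteq> traces" "\<tau> \<in> destutter A"
  then obtain s \<sigma> where "s # \<sigma> \<in> A" "\<tau> = remdups_adj (s # \<sigma>)"
    by (auto simp: destutter_def traces_def neq_Nil_conv subset_iff)
  then have "s # s # \<sigma> \<in> sharp A" "\<tau> = remdups_adj (s # s # \<sigma>)"
    by (auto simp: sharp_def)
  then show "\<tau> \<in> destutter (sharp A)"
    unfolding destutter_iff by blast
qed

text \<open>Destuttering keeps the first state, and that is all that \<open>restrict\<close>
  inspects.\<close>

lemma destutter_restrict_le:
  assumes "destutter A \<subseteq> destutter B"
  shows "destutter (restrict A P) \<subseteq> destutter (restrict B P)"
proof
  fix \<tau> assume "\<tau> \<in> destutter (restrict A P)"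
  then obtain s \<sigma> where s: "s # \<sigma> \<in> A" "P s" "\<tau> = remdups_adj (s # \<sigma>)"
    by (auto simp: destutter_def restrict_def)
  then obtain \<sigma>' where B: "\<sigma>' \<in> B" "remdups_adj (s # \<sigma>) = remdups_adj \<sigma>'"
    using assms by (auto simp: destutter_def image_subset_iff)
  have "\<sigma>' \<noteq> []" "hd \<sigma>' = s"
    using B(2) hd_remdups_adj[of \<sigma>'] hd_remdups_adj[of "s # \<sigma>"] by auto
  then have "\<sigma>' \<in> restrict B P"
    using B s by (auto simp: restrict_def neq_Nil_conv)
  then show "\<tau> \<in> destutter (restrict B P)"
    using B(2) s(3) by (auto simp: destutter_iff)
qed

text \<open>Destuttering keeps both end states, so the replacement traces still meet in
  \<open>s\<close>; the destuttered chop depends only on the destuttered pieces.\<close>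

lemma destutter_chop_le:
  assumes "destutter A \<subseteq> destutter A'" "destutter B \<subseteq> destutter B'"
  shows "destutter (chop A B) \<subseteq> destutter (chop A' B')"
proof
  fix \<tau> assume "\<tau> \<in> destutter (chop A B)"
  then obtain \<sigma>A s \<sigma>B where s: "\<sigma>A @ [s] \<in> A" "s # \<sigma>B \<in> B" "\<tau> = remdups_adj (\<sigma>A @ s # \<sigma>B)"
    by (auto simp: destutter_def chop_def)
  obtain \<alpha> where \<alpha>: "\<alpha> \<in> A'" "remdups_adj (\<sigma>A @ [s]) = remdups_adj \<alpha>"
    using assms(1) s(1) by (auto simp: destutter_def image_subset_iff)
  obtain \<beta> where \<beta>: "\<beta> \<in> B'" "remdups_adj (s # \<sigma>B) = remdups_adj \<beta>"
    using assms(2) s(2) by (auto simp: destutter_def image_subset_iff)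
  have "\<alpha> \<noteq> []" "last \<alpha> = s"
    using \<alpha>(2) last_remdups_adj[of \<alpha>] last_remdups_adj[of "\<sigma>A @ [s]"] by auto
  then obtain \<alpha>' where \<alpha>': "\<alpha> = \<alpha>' @ [s]"
    by (metis append_butlast_last_id)
  have "\<beta> \<noteq> []" "hd \<beta> = s"
    using \<beta>(2) hd_remdups_adj[of \<beta>] hd_remdups_adj[of "s # \<sigma>B"] by auto
  then obtain \<beta>' where \<beta>': "\<beta> = s # \<beta>'"
    by (auto simp: neq_Nil_conv)
  \<comment> \<open>\<open>tl\<close> removes the shared state \<open>s\<close>, which would
    otherwise be counted in both pieces.\<close>
  have "\<tau> = remdups_adj (\<sigma>A @ [s]) @ tl (remdups_adj (s # \<sigma>B))"
    unfolding s(3) by (rule remdups_adj_append)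
  also have "\<dots> = remdups_adj (\<alpha>' @ s # \<beta>')"
    unfolding \<alpha>(2) \<beta>(2) \<alpha>' \<beta>' by (rule remdups_adj_append[symmetric])
  finally show "\<tau> \<in> destutter (chop A' B')"
    using \<alpha>(1) \<beta>(1) by (auto simp: destutter_iff chop_def \<alpha>' \<beta>')
qed

text \<open>The closure of \<open>A\<close> under stutter equivalence. It turns inclusion up to
  stuttering into plain inclusion, the form in which both least fixed points state their
  prefixed-point conditions.\<close>

definition saturate :: "'v trace set \<Rightarrow> 'v trace set" where
  "saturate A = {\<sigma>. remdups_adj \<sigma> \<in> destutter A}"

lemma subset_saturate_iff: "B \<subseteq> saturate A \<longleftrightarrow> destutter B \<subseteq> destutter A"
  by (auto simp: saturate_def destutter_def)

lemma destutter_saturate_le: "destutter (saturate A) \<subseteq> destutter A"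
  by (auto simp: saturate_def destutter_def)

section \<open>Semantics of formulas and statements\<close>

lemma formula_sem_Conj: "formula_sem \<A> \<B> (Conj p \<phi>) V = restrict (formula_sem \<A> \<B> \<phi> V) (\<B> p)"
  by (auto simp: restrict_def)

lemma chop_mono: "A \<subseteq> A' \<Longrightarrow> B \<subseteq> B' \<Longrightarrow> chop A B \<subseteq> chop A' B'"
  unfolding chop_def by blast

text \<open>Under \<open>Mu\<close>, a larger environment has fewer prefixed points, so their
  intersection grows.\<close>

lemma formula_sem_mono: "V \<le> V' \<Longrightarrow> formula_sem \<A> \<B> \<phi> V \<subseteq> formula_sem \<A> \<B> \<phi> V'"
proof (induction \<phi> arbitrary: V V')
  case (Conj p \<phi>)
  from Conj.IH[OF Conj.prems] show ?case by auto
next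
  case (Disj \<phi> \<psi>)
  from Disj.IH[OF Disj.prems] show ?case by auto
next
  case (Chop \<phi> \<psi>)
  from Chop.IH[OF Chop.prems] show ?case by (simp add: chop_mono)
next
  case (Mu X \<phi>)
  have "formula_sem \<A> \<B> \<phi> (V(X := \<gamma>)) \<subseteq> formula_sem \<A> \<B> \<phi> (V'(X := \<gamma>))" for \<gamma>
    using Mu.prems by (intro Mu.IH) (auto simp: le_fun_def)
  then show ?case
    unfolding formula_sem.simps by (intro Inter_anti_mono Collect_mono) (meson order_trans)
qed (auto simp: le_fun_def)

text \<open>The Knaster-Tarski argument: by monotonicity, the intersection of all prefixed points is
  itself prefixed.\<close>

lemma formula_sem_Mu_prefixed:
  "formula_sem \<A> \<B> \<phi> (V(X := formula_sem \<A> \<B> (Mu X \<phi>) V)) \<subseteq> formula_sem \<A> \<B> (Mu X \<phi>) V"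
proof -
  have "formula_sem \<A> \<B> \<phi> (V(X := formula_sem \<A> \<B> (Mu X \<phi>) V)) \<subseteq> \<gamma>"
    if "\<gamma> \<subseteq> traces" "formula_sem \<A> \<B> \<phi> (V(X := \<gamma>)) \<subseteq> \<gamma>" for \<gamma>
  proof -
    have "V(X := formula_sem \<A> \<B> (Mu X \<phi>) V) \<le> V(X := \<gamma>)"
      using that by (auto simp: le_fun_def)
    from formula_sem_mono[OF this] that(2) show ?thesis by blast
  qed
  then show ?thesis by auto
qed

lemma stmt_sem_traces:
  assumes "\<And>m. \<rho> m \<subseteq> traces"
  shows "stmt_sem \<A> \<B> \<rho> S \<subseteq> traces"
  using assms by (induction S) (auto simp: traces_def chop_def restrict_def sharp_def)

primrec calls :: "('v, 'a, 'b, 'm) stmt \<Rightarrow> 'm set" where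
  "calls Skip = {}"
| "calls (Assign x a) = {}"
| "calls (Seq S1 S2) = calls S1 \<union> calls S2"
| "calls (If b S1 S2) = calls S1 \<union> calls S2"
| "calls (IfStar S1 S2) = calls S1 \<union> calls S2"
| "calls (Call m) = {m}"

text \<open>Allows one family of procedure meanings to replace another when families for two
  subformulas are merged.\<close>

lemma stmt_sem_cong:
  "(\<And>m. m \<in> calls S \<Longrightarrow> \<rho> m = \<rho>' m) \<Longrightarrow> stmt_sem \<A> \<B> \<rho> S = stmt_sem \<A> \<B> \<rho>' S"
  by (induction S) auto

section \<open>Canonical programs\<close>

text \<open>Projections instead of \<open>let\<close> with pair patterns, so that inductions need no
  case splits on pairs.\<close>

lemma can_compound [simp]:
  "can (Conj p \<phi>) = (If p (fst (can \<phi>)) diverge, snd (can \<phi>) @ [(Abort, Call Abort)])"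
  "can (Disj \<phi> \<psi>) = (IfStar (fst (can \<phi>)) (fst (can \<psi>)), snd (can \<phi>) @ snd (can \<psi>))"
  "can (Chop \<phi> \<psi>) = (Seq (fst (can \<phi>)) (fst (can \<psi>)), snd (can \<phi>) @ snd (can \<psi>))"
  "can (Mu X \<phi>) = (Call (Proc X), snd (can \<phi>) @ [(Proc X, fst (can \<phi>))])"
  by (simp_all add: case_prod_beta)

declare can.simps(4-7) [simp del]

text \<open>An upper bound on the procedures called by the canonical statement and by the bodies in
  its table; those bodies may call procedures of bound variables.\<close>

abbreviation (input) can_names :: "('v, 'a, 'b, 'x) formula \<Rightarrow> 'x proc_name set" where
  "can_names \<phi> \<equiv> insert Abort (Proc ` (free_vars \<phi> \<union> set (binders \<phi>)))"

lemma calls_can_stmt: "calls (fst (can \<phi>)) \<subseteq> can_names \<phi>"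
  by (induction \<phi>) auto

lemma calls_can_table: "(m, S) \<in> set (snd (can \<phi>)) \<Longrightarrow> calls S \<subseteq> can_names \<phi>"
proof (induction \<phi>)
  case (Mu X \<phi>)
  then show ?case
    using calls_can_stmt[of \<phi>] by fastforce
qed fastforce+

lemma can_table_Proc: "(Proc X, S) \<in> set (snd (can \<phi>)) \<Longrightarrow> X \<in> set (binders \<phi>)"
  by (induction \<phi>) auto

lemma can_table_Abort: "(Abort, S) \<in> set (snd (can \<phi>)) \<Longrightarrow> S = Call Abort"
  by (induction \<phi>) auto

lemma can_table_unique:
  assumes "distinct (binders \<phi>)" "(Proc X, S) \<in> set (snd (can \<phi>))" "(Proc X, S') \<in> set (snd (can \<phi>))"
  shows "S = S'"
  using assms by (induction \<phi>) (auto dest: can_table_Proc)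

text \<open>\<open>map_of\<close> returns the first entry for a key; with distinct binders all
  entries for \<open>Proc X\<close> coincide.\<close>

lemma map_of_can_table:
  assumes "distinct (binders \<phi>)" "(Proc X, S) \<in> set (snd (can \<phi>))"
  shows "map_of (snd (can \<phi>)) (Proc X) = Some S"
  using weak_map_of_SomeI[OF assms(2)] can_table_unique[OF assms] map_of_SomeD by metis

section \<open>The two inclusions\<close>

text \<open>Stated for open formulas, with \<open>V\<close> matched to \<open>\<rho>\<close> only up
  to stuttering, so that the induction can pass under \<open>Mu\<close> with a saturated value for
  the bound variable.\<close>

lemma formula_le_program:
  assumes "\<And>m. \<rho> m \<subseteq> traces"
    and "\<And>X S. (Proc X, S) \<in> set (snd (can \<phi>)) \<Longrightarrow> sharp (stmt_sem \<A> \<B> \<rho> S) \<subseteq> \<rho> (Proc X)"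
    and "\<And>X. X \<in> free_vars \<phi> \<Longrightarrow> destutter (V X) \<subseteq> destutter (\<rho> (Proc X))"
  shows "destutter (formula_sem \<A> \<B> \<phi> V) \<subseteq> destutter (stmt_sem \<A> \<B> \<rho> (fst (can \<phi>)))"
  using assms(2,3)
proof (induction \<phi> arbitrary: V)
  case (Conj p \<phi>)
  let ?S = "stmt_sem \<A> \<B> \<rho> (fst (can \<phi>))"
  have "destutter (formula_sem \<A> \<B> \<phi> V) \<subseteq> destutter ?S"
    by (rule Conj.IH; rule Conj.prems) auto
  also have "\<dots> = destutter (sharp ?S)"
    by (rule destutter_sharp[symmetric]) (rule stmt_sem_traces[OF assms(1)])
  finally have "destutter (restrict (formula_sem \<A> \<B> \<phi> V) (\<B> p))
      \<subseteq> destutter (restrict (sharp ?S) (\<B> p))"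
    by (rule destutter_restrict_le)
  \<comment> \<open>The \<open>diverge\<close> branch can only enlarge the program side.\<close>
  then show ?case
    unfolding formula_sem_Conj by (auto simp: destutter_Un)
next
  case (Disj \<phi> \<psi>)
  have "destutter (formula_sem \<A> \<B> \<phi> V) \<subseteq> destutter (stmt_sem \<A> \<B> \<rho> (fst (can \<phi>)))"
    by (rule Disj.IH; rule Disj.prems) auto
  moreover have "destutter (formula_sem \<A> \<B> \<psi> V) \<subseteq> destutter (stmt_sem \<A> \<B> \<rho> (fst (can \<psi>)))"
    by (rule Disj.IH; rule Disj.prems) auto
  ultimately show ?case
    by (simp add: destutter_Un destutter_sharp stmt_sem_traces[OF assms(1)] le_supI1 le_supI2)
next
  case (Chop \<phi> \<psi>)
  have "destutter (formula_sem \<A> \<B> \<phi> V) \<subseteq> destutter (stmt_sem \<A> \<B> \<rho> (fst (can \<phi>)))"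
    by (rule Chop.IH; rule Chop.prems) auto
  moreover have "destutter (formula_sem \<A> \<B> \<psi> V) \<subseteq> destutter (stmt_sem \<A> \<B> \<rho> (fst (can \<psi>)))"
    by (rule Chop.IH; rule Chop.prems) auto
  ultimately show ?case
    by (simp add: destutter_chop_le)
next
  case (Mu X \<phi>)
  \<comment> \<open>The candidate prefixed point. Without saturation the body would be included in
    it only up to stuttering.\<close>
  let ?\<gamma> = "saturate (\<rho> (Proc X))" and ?S = "stmt_sem \<A> \<B> \<rho> (fst (can \<phi>))"
  have "destutter (formula_sem \<A> \<B> \<phi> (V(X := ?\<gamma>))) \<subseteq> destutter ?S"
  proof (rule Mu.IH)
    show "sharp (stmt_sem \<A> \<B> \<rho> S) \<subseteq> \<rho> (Proc Y)" if "(Proc Y, S) \<in> set (snd (can \<phi>))" for Y S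
      using that by (intro Mu.prems(1)) auto
    show "destutter ((V(X := ?\<gamma>)) Y) \<subseteq> destutter (\<rho> (Proc Y))" if "Y \<in> free_vars \<phi>" for Y
      using that Mu.prems(2)[of Y] destutter_saturate_le by auto
  qed
  also have "\<dots> = destutter (sharp ?S)"
    by (rule destutter_sharp[symmetric]) (rule stmt_sem_traces[OF assms(1)])
  also have "\<dots> \<subseteq> destutter (\<rho> (Proc X))"
    by (intro destutter_mono Mu.prems(1)) auto
  finally have "formula_sem \<A> \<B> \<phi> (V(X := ?\<gamma>)) \<subseteq> ?\<gamma>"
    by (simp add: subset_saturate_iff)
  moreover have "?\<gamma> \<subseteq> traces"
    using destutter_le_traces[OF destutter_saturate_le assms(1)] .
  ultimately have "formula_sem \<A> \<B> (Mu X \<phi>) V \<subseteq> ?\<gamma>"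
    by auto
  then show ?case
    by (auto simp: subset_saturate_iff)
qed auto

section \<open>From the program to the formula\<close>

text \<open>
  \<open>\<rho>\<close> is a prefixed point for the declarations of \<open>can \<phi>\<close> whose value at the procedure of a variable
  not bound in \<open>\<phi>\<close> is prescribed by \<open>V\<close>; the prescription lets the families obtained for the two
  halves of a disjunction or chop be merged.
\<close>

definition models_can ::
  "('a \<Rightarrow> 'v state \<Rightarrow> int) \<Rightarrow> ('b \<Rightarrow> 'v state \<Rightarrow> bool) \<Rightarrow> ('v, 'a, 'b, 'x) formula
    \<Rightarrow> ('x \<Rightarrow> 'v trace set) \<Rightarrow> ('x proc_name \<Rightarrow> 'v trace set) \<Rightarrow> bool" where
  "models_can \<A> \<B> \<phi> V \<rho> \<longleftrightarrow>
     \<rho> Abort = {} \<and>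
     (\<forall>X. X \<notin> set (binders \<phi>) \<longrightarrow> \<rho> (Proc X) = saturate (V X)) \<and>
     (\<forall>X S. (Proc X, S) \<in> set (snd (can \<phi>)) \<longrightarrow> sharp (stmt_sem \<A> \<B> \<rho> S) \<subseteq> \<rho> (Proc X)) \<and>
     destutter (stmt_sem \<A> \<B> \<rho> (fst (can \<phi>))) \<subseteq> destutter (formula_sem \<A> \<B> \<phi> V)"

text \<open>A variable occurring in one half is never bound in the other, so a merged family can
  agree with each given family on all names relevant to its half.\<close>

lemma models_can_merge:
  assumes "models_can \<A> \<B> \<phi> V \<rho>1" "models_can \<A> \<B> \<psi> V \<rho>2"
    and "set (binders \<phi>) \<inter> set (binders \<psi>) = {}"
    and "free_vars \<phi> \<inter> set (binders \<psi>) = {}" "free_vars \<psi> \<inter> set (binders \<phi>) = {}"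
  obtains \<rho> where "\<rho> Abort = {}"
    and "\<And>X. X \<notin> set (binders \<phi>) \<union> set (binders \<psi>) \<Longrightarrow> \<rho> (Proc X) = saturate (V X)"
    and "\<And>X S. (Proc X, S) \<in> set (snd (can \<phi>)) \<union> set (snd (can \<psi>))
            \<Longrightarrow> sharp (stmt_sem \<A> \<B> \<rho> S) \<subseteq> \<rho> (Proc X)"
    and "destutter (stmt_sem \<A> \<B> \<rho> (fst (can \<phi>))) \<subseteq> destutter (formula_sem \<A> \<B> \<phi> V)"
    and "destutter (stmt_sem \<A> \<B> \<rho> (fst (can \<psi>))) \<subseteq> destutter (formula_sem \<A> \<B> \<psi> V)"
proof -
  define \<rho> where "\<rho> m = (if m \<in> Proc ` set (binders \<phi>) then \<rho>1 m else \<rho>2 m)" for m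
  have eq1: "\<rho> m = \<rho>1 m" if "m \<in> can_names \<phi>" for m
  proof (cases m)
    case Abort
    then show ?thesis using assms(1,2) by (simp add: \<rho>_def models_can_def)
  next
    case (Proc X)
    then have "X \<notin> set (binders \<psi>)"
      using that assms(3-5) by auto
    \<comment> \<open>If \<open>X\<close> is not bound in \<open>\<phi>\<close> either, both
      families take the prescribed value \<open>saturate (V X)\<close>.\<close>
    then show ?thesis
      using Proc assms(1,2) by (auto simp: \<rho>_def models_can_def)
  qed
  have eq2: "\<rho> m = \<rho>2 m" if "m \<in> can_names \<psi>" for m
  proof (cases m)
    case Abort
    then show ?thesis using assms(1,2) by (simp add: \<rho>_def models_can_def)
  next
    case (Proc X)
    then have "X \<notin> set (binders \<phi>)"
      using that assms(3-5) by auto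
    then show ?thesis
      using Proc assms(1,2) by (auto simp: \<rho>_def models_can_def)
  qed
  have stmt1: "stmt_sem \<A> \<B> \<rho> (fst (can \<phi>)) = stmt_sem \<A> \<B> \<rho>1 (fst (can \<phi>))"
    using calls_can_stmt[of \<phi>] eq1 by (intro stmt_sem_cong) blast
  have stmt2: "stmt_sem \<A> \<B> \<rho> (fst (can \<psi>)) = stmt_sem \<A> \<B> \<rho>2 (fst (can \<psi>))"
    using calls_can_stmt[of \<psi>] eq2 by (intro stmt_sem_cong) blast
  have tab1: "sharp (stmt_sem \<A> \<B> \<rho> S) \<subseteq> \<rho> (Proc X)" if "(Proc X, S) \<in> set (snd (can \<phi>))" for X S
  proof -
    have "stmt_sem \<A> \<B> \<rho> S = stmt_sem \<A> \<B> \<rho>1 S"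
      using calls_can_table[OF that] eq1 by (intro stmt_sem_cong) blast
    moreover have "\<rho> (Proc X) = \<rho>1 (Proc X)"
      using can_table_Proc[OF that] by (intro eq1) blast
    ultimately show ?thesis
      using assms(1) that unfolding models_can_def by simp
  qed
  have tab2: "sharp (stmt_sem \<A> \<B> \<rho> S) \<subseteq> \<rho> (Proc X)" if "(Proc X, S) \<in> set (snd (can \<psi>))" for X S
  proof -
    have "stmt_sem \<A> \<B> \<rho> S = stmt_sem \<A> \<B> \<rho>2 S"
      using calls_can_table[OF that] eq2 by (intro stmt_sem_cong) blast
    moreover have "\<rho> (Proc X) = \<rho>2 (Proc X)"
      using can_table_Proc[OF that] by (intro eq2) blast
    ultimately show ?thesis
      using assms(2) that unfolding models_can_def by simp
  qed
  show thesis
  proof (rule that[of \<rho>])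
    show "\<rho> Abort = {}"
      using assms(2) by (auto simp: \<rho>_def models_can_def)
    show "\<rho> (Proc X) = saturate (V X)" if "X \<notin> set (binders \<phi>) \<union> set (binders \<psi>)" for X
      using that assms(2) by (auto simp: \<rho>_def models_can_def)
    show "sharp (stmt_sem \<A> \<B> \<rho> S) \<subseteq> \<rho> (Proc X)"
      if "(Proc X, S) \<in> set (snd (can \<phi>)) \<union> set (snd (can \<psi>))" for X S
      using that tab1 tab2 by blast
    show "destutter (stmt_sem \<A> \<B> \<rho> (fst (can \<phi>))) \<subseteq> destutter (formula_sem \<A> \<B> \<phi> V)"
      using assms(1) unfolding stmt1 models_can_def by blast
    show "destutter (stmt_sem \<A> \<B> \<rho> (fst (can \<psi>))) \<subseteq> destutter (formula_sem \<A> \<B> \<psi> V)"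
      using assms(2) unfolding stmt2 models_can_def by blast
  qed
qed

text \<open>\<open>V\<close> is generalized because the body of \<open>Mu X\<close> is treated in an
  updated environment. Unique naming keeps the value chosen for \<open>Proc X\<close> at its binder
  from clashing with another one.\<close>

lemma ex_models_can:
  assumes "distinct (binders \<phi>)" "free_vars \<phi> \<inter> set (binders \<phi>) = {}"
  shows "\<exists>\<rho>. models_can \<A> \<B> \<phi> V \<rho>"
  using assms
proof (induction \<phi> arbitrary: V)
  case Id
  show ?case
    \<comment> \<open>Without binders, \<open>models_can\<close> forces exactly this family.\<close>
    by (rule exI[of _ "\<lambda>m. case m of Abort \<Rightarrow> {} | Proc X \<Rightarrow> saturate (V X)"])
      (simp add: models_can_def)
next
  case (Sb x a)
  show ?case
    by (rule exI[of _ "\<lambda>m. case m of Abort \<Rightarrow> {} | Proc X \<Rightarrow> saturate (V X)"])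
      (simp add: models_can_def)
next
  case (Var X)
  show ?case
    by (rule exI[of _ "\<lambda>m. case m of Abort \<Rightarrow> {} | Proc X \<Rightarrow> saturate (V X)"])
      (simp add: models_can_def destutter_saturate_le)
next
  case (Conj p \<phi>)
  then obtain \<rho> where \<rho>: "models_can \<A> \<B> \<phi> V \<rho>"
    by fastforce
  let ?S = "stmt_sem \<A> \<B> \<rho> (fst (can \<phi>))"
  have "destutter (sharp ?S) \<subseteq> destutter (formula_sem \<A> \<B> \<phi> V)"
    using \<rho> destutter_sharp_le[of ?S] by (auto simp: models_can_def)
  then have "destutter (restrict (sharp ?S) (\<B> p)) \<subseteq> destutter (formula_sem \<A> \<B> (Conj p \<phi>) V)"
    unfolding formula_sem_Conj by (rule destutter_restrict_le)
  \<comment> \<open>The \<open>diverge\<close> branch vanishes because \<open>\<rho> Abort\<close>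
    is empty.\<close>
  moreover have "stmt_sem \<A> \<B> \<rho> (fst (can (Conj p \<phi>))) = restrict (sharp ?S) (\<B> p)"
    using \<rho> by (auto simp: models_can_def sharp_def restrict_def)
  ultimately have "models_can \<A> \<B> (Conj p \<phi>) V \<rho>"
    using \<rho> unfolding models_can_def by (simp del: formula_sem.simps stmt_sem.simps)
  then show ?case by blast
next
  case (Disj \<phi> \<psi>)
  then obtain \<rho>1 \<rho>2 where "models_can \<A> \<B> \<phi> V \<rho>1" "models_can \<A> \<B> \<psi> V \<rho>2"
    by fastforce
  then obtain \<rho> where \<rho>: "\<rho> Abort = {}"
    "\<And>X. X \<notin> set (binders \<phi>) \<union> set (binders \<psi>) \<Longrightarrow> \<rho> (Proc X) = saturate (V X)"
    "\<And>X S. (Proc X, S) \<in> set (snd (can \<phi>)) \<union> set (snd (can \<psi>))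
            \<Longrightarrow> sharp (stmt_sem \<A> \<B> \<rho> S) \<subseteq> \<rho> (Proc X)"
    "destutter (stmt_sem \<A> \<B> \<rho> (fst (can \<phi>))) \<subseteq> destutter (formula_sem \<A> \<B> \<phi> V)"
    "destutter (stmt_sem \<A> \<B> \<rho> (fst (can \<psi>))) \<subseteq> destutter (formula_sem \<A> \<B> \<psi> V)"
    by (rule models_can_merge) (use Disj.prems in auto)
  then have "models_can \<A> \<B> (Disj \<phi> \<psi>) V \<rho>"
    unfolding models_can_def
    by (simp add: destutter_Un le_supI1[OF order_trans[OF destutter_sharp_le]]
        le_supI2[OF order_trans[OF destutter_sharp_le]])
  then show ?case by blast
next
  case (Chop \<phi> \<psi>)
  then obtain \<rho>1 \<rho>2 where "models_can \<A> \<B> \<phi> V \<rho>1" "models_can \<A> \<B> \<psi> V \<rho>2"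
    by fastforce
  then obtain \<rho> where \<rho>: "\<rho> Abort = {}"
    "\<And>X. X \<notin> set (binders \<phi>) \<union> set (binders \<psi>) \<Longrightarrow> \<rho> (Proc X) = saturate (V X)"
    "\<And>X S. (Proc X, S) \<in> set (snd (can \<phi>)) \<union> set (snd (can \<psi>))
            \<Longrightarrow> sharp (stmt_sem \<A> \<B> \<rho> S) \<subseteq> \<rho> (Proc X)"
    "destutter (stmt_sem \<A> \<B> \<rho> (fst (can \<phi>))) \<subseteq> destutter (formula_sem \<A> \<B> \<phi> V)"
    "destutter (stmt_sem \<A> \<B> \<rho> (fst (can \<psi>))) \<subseteq> destutter (formula_sem \<A> \<B> \<psi> V)"
    by (rule models_can_merge) (use Chop.prems in auto)
  then have "models_can \<A> \<B> (Chop \<phi> \<psi>) V \<rho>"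
    unfolding models_can_def by (simp add: destutter_chop_le)
  then show ?case by blast
next
  case (Mu X \<phi>)
  let ?\<gamma> = "formula_sem \<A> \<B> (Mu X \<phi>) V"
  have "distinct (binders \<phi>)" "free_vars \<phi> \<inter> set (binders \<phi>) = {}" "X \<notin> set (binders \<phi>)"
    using Mu.prems by auto
  with Mu.IH obtain \<rho> where \<rho>: "models_can \<A> \<B> \<phi> (V(X := ?\<gamma>)) \<rho>"
    by blast
  \<comment> \<open>\<open>X\<close> is not bound again inside \<open>\<phi>\<close>, so the
    invariant for the body prescribes the value at \<open>Proc X\<close>.\<close>
  with \<open>X \<notin> set (binders \<phi>)\<close> have X: "\<rho> (Proc X) = saturate ?\<gamma>"
    unfolding models_can_def by simp
  let ?S = "stmt_sem \<A> \<B> \<rho> (fst (can \<phi>))"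
  have "destutter (sharp ?S) \<subseteq> destutter ?S"
    by (rule destutter_sharp_le)
  also have "\<dots> \<subseteq> destutter (formula_sem \<A> \<B> \<phi> (V(X := ?\<gamma>)))"
    using \<rho> unfolding models_can_def by blast
  also have "\<dots> \<subseteq> destutter ?\<gamma>"
    by (rule destutter_mono) (rule formula_sem_Mu_prefixed)
  \<comment> \<open>Saturation absorbs the extra initial state that \<open>sharp\<close> adds for
    the call; this is the condition for the new declaration of \<open>Proc X\<close>.\<close>
  finally have "sharp ?S \<subseteq> \<rho> (Proc X)"
    unfolding X subset_saturate_iff .
  moreover have "destutter (stmt_sem \<A> \<B> \<rho> (Call (Proc X))) \<subseteq> destutter ?\<gamma>"
    by (simp only: stmt_sem.simps X destutter_saturate_le)
  ultimately have "models_can \<A> \<B> (Mu X \<phi>) V \<rho>"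
    using \<rho> unfolding models_can_def by (auto simp del: formula_sem.simps stmt_sem.simps)
  then show ?case by blast
qed

theorem mainTheorem10:
  fixes \<A> :: "'a \<Rightarrow> 'v state \<Rightarrow> int"
    and \<B> :: "'b \<Rightarrow> 'v state \<Rightarrow> bool"
    and \<phi> :: "('v, 'a, 'b, 'x) formula"
    and S :: "('v, 'a, 'b, 'x proc_name) stmt"
    and T :: "('v, 'a, 'b, 'x proc_name) proc_table"
    and V :: "'x \<Rightarrow> 'v trace set"
  assumes "closed \<phi>"
    and "uniquely_named \<phi>"
    and "can \<phi> = (S, T)"
  shows "stutter_equiv (S_tr \<A> \<B> T S) (formula_sem \<A> \<B> \<phi> V)"
proof -
  have ST: "S = fst (can \<phi>)" "T = snd (can \<phi>)"
    using assms(3) by auto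
  have distinct: "distinct (binders \<phi>)" and disjoint: "free_vars \<phi> \<inter> set (binders \<phi>) = {}"
    using assms(2) by (auto simp: uniquely_named_def)
  let ?\<rho>0 = "rho0 \<A> \<B> T"
  have "destutter (formula_sem \<A> \<B> \<phi> V) \<subseteq> destutter (stmt_sem \<A> \<B> ?\<rho>0 (fst (can \<phi>)))"
  proof (rule formula_le_program)
    show "?\<rho>0 m \<subseteq> traces" for m
      by (rule rho0_traces)
    show "sharp (stmt_sem \<A> \<B> ?\<rho>0 S') \<subseteq> ?\<rho>0 (Proc X)"
      if "(Proc X, S') \<in> set (snd (can \<phi>))" for X S'
    proof -
      \<comment> \<open>One unfolding of the fixed point, in which \<open>map_of\<close> finds
        precisely the body \<open>S'\<close>.\<close>
      have "?\<rho>0 (Proc X) = table_step \<A> \<B> T ?\<rho>0 (Proc X)"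
        unfolding rho0_def by (rule fun_cong[OF lfp_unfold[OF table_step_mono]])
      then show ?thesis
        using map_of_can_table[OF distinct that] by (simp add: table_step_def ST)
    qed
    \<comment> \<open>Vacuous, as \<open>\<phi>\<close> is closed.\<close>
    show "destutter (V X) \<subseteq> destutter (?\<rho>0 (Proc X))" if "X \<in> free_vars \<phi>" for X
      using that assms(1) by (simp add: closed_def)
  qed
  moreover
  obtain \<rho> where \<rho>: "models_can \<A> \<B> \<phi> V \<rho>"
    using ex_models_can[OF distinct disjoint] by blast
  have "table_step \<A> \<B> T \<rho> m \<subseteq> \<rho> m" for m
  proof (cases "map_of T m")
    case None
    then show ?thesis by (simp add: table_step_def)
  next
    case (Some S')
    then have "(m, S') \<in> set (snd (can \<phi>))"
      unfolding ST by (rule map_of_SomeD)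
    then have "sharp (stmt_sem \<A> \<B> \<rho> S') \<subseteq> \<rho> m"
      \<comment> \<open>For \<open>Abort\<close> the body is \<open>Call Abort\<close>, whose
        meaning under \<open>\<rho>\<close> is empty.\<close>
      using \<rho> can_table_Abort[of S' \<phi>] by (cases m) (auto simp: models_can_def sharp_def)
    with Some show ?thesis by (simp add: table_step_def)
  qed
  \<comment> \<open>The least fixed point lies below every prefixed point; monotonicity of
    \<open>stmt_sem\<close> carries this to the canonical statement.\<close>
  then have "?\<rho>0 \<le> \<rho>"
    unfolding rho0_def by (intro lfp_lowerbound le_funI)
  then have "destutter (stmt_sem \<A> \<B> ?\<rho>0 (fst (can \<phi>))) \<subseteq> destutter (stmt_sem \<A> \<B> \<rho> (fst (can \<phi>)))"
    by (intro destutter_mono stmt_sem_mono)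
  then have "destutter (stmt_sem \<A> \<B> ?\<rho>0 (fst (can \<phi>))) \<subseteq> destutter (formula_sem \<A> \<B> \<phi> V)"
    using \<rho> unfolding models_can_def by blast
  ultimately show ?thesis
    unfolding stutter_equiv_def S_tr_def ST by (rule antisym[rotated])
qed

end
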